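(* For all integers $k\geq 3$ and $\ell\in \mathbb{N}$, and all sufficiently large $n$, \[ \operatorname{sat}_k(n,\text{Berge-}K_{1,\ell})=\min_{a\in[n],\ \binom{a-1}{k-1}\leq \ell-2} \left(\left\lceil\frac{(\ell-1)(n-a)}k\right\rceil+\binom{a}k\right). \]
   Context: $[n]=\{1,\dots,n\}$, and $K_{1,\ell}$ is the star with one center and $\ell$ leaves. A $k$-uniform hypergraph $H$ has edges that are $k$-element subsets of $V(H)$ (no repeated edges). Given a graph $G$, a $k$-uniform hypergraph $H$ contains a Berge-$G$ if there is an injection $\phi:E(G)\to E(H)$, with $G$ embedded on vertices of $H$, such that $e\subseteq \phi(e)$ for every $e\in E(G)$. A $k$-uniform hypergraph $H$ is Berge-$G$-saturated if $H$ contains no Berge-$G$, but for every $k$-subset $e$ of $V(H)$ with $e\notin E(H)$, the hypergraph $H+e$ contains a Berge-$G$. The saturation number $\operatorname{sat}_k(n,\text{Berge-}G)$ is the minimum number of edges of a Berge-$G$-saturated $k$-uniform hypergraph on $n$ vertices.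
   Formalization: For ℓ=1 the printed minimum ranges over an empty set; there ℓ−2 is read as 0, so both sides equal 0. ℕ is taken to start at 1; for ℓ≥2 the statement is as printed. *)

theory Defs
  imports Complex_Main
begin

text \<open>A graph or hypergraph is given by a vertex set and a set of edges, each edge being a set
  of vertices.\<close>

definition uniform_hypergraph :: "nat \<Rightarrow> 'a set \<Rightarrow> 'a set set \<Rightarrow> bool" where
  "uniform_hypergraph k V E \<longleftrightarrow> finite V \<and> (\<forall>e\<in>E. e \<subseteq> V \<and> card e = k)"

text \<open>The map \<open>\<psi>\<close> is the embedding of the vertices of the graph, \<open>\<phi>\<close> the injection on its edges.\<close>

definition contains_berge ::
    "'b set \<Rightarrow> 'b set set \<Rightarrow> 'a set \<Rightarrow> 'a set set \<Rightarrow> bool" where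
  "contains_berge VG EG V E \<longleftrightarrow>
     (\<exists>\<psi> \<phi>. inj_on \<psi> VG \<and> \<psi> ` VG \<subseteq> V \<and> inj_on \<phi> EG \<and> \<phi> ` EG \<subseteq> E \<and>
        (\<forall>e\<in>EG. \<psi> ` e \<subseteq> \<phi> e))"

definition berge_saturated ::
    "'b set \<Rightarrow> 'b set set \<Rightarrow> nat \<Rightarrow> 'a set \<Rightarrow> 'a set set \<Rightarrow> bool" where
  "berge_saturated VG EG k V E \<longleftrightarrow>
     uniform_hypergraph k V E \<and> \<not> contains_berge VG EG V E \<and>
     (\<forall>e. e \<subseteq> V \<and> card e = k \<and> e \<notin> E \<longrightarrow> contains_berge VG EG V (insert e E))"

text \<open>Every finite hypergraph is isomorphic to one whose vertices are natural numbers, so the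
  minimum is taken over those.\<close>

definition berge_sat :: "nat \<Rightarrow> nat \<Rightarrow> 'b set \<Rightarrow> 'b set set \<Rightarrow> nat" where
  "berge_sat k n VG EG =
     (LEAST m. \<exists>(V :: nat set) E. card V = n \<and> berge_saturated VG EG k V E \<and> card E = m)"

text \<open>The star \<open>K\<^bsub>1,l\<^esub>\<close> has center \<open>0\<close> and leaves \<open>1, \<dots>, l\<close>.\<close>

definition star_vertices :: "nat \<Rightarrow> nat set" where
  "star_vertices l = {0..l}"

definition star_edges :: "nat \<Rightarrow> nat set set" where
  "star_edges l = (\<lambda>i. {0, i}) ` {1..l}"

end

theory Submission
  imports Defs
begin

text \<open>
  Lower bound: in a saturated hypergraph the set \<open>A\<close> of vertices of degree at most \<open>l - 2\<close> spans all
  of its \<open>k\<close>-subsets, because adding a missing one could not raise any of its vertices to degree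
  \<open>l\<close>. Counting the incidences outside \<open>A\<close> gives the bound with \<open>a = card A\<close>.

  Upper bound: take a clique on \<open>a \<ge> k - 1\<close> vertices and a linear \<open>(l - 1)\<close>-regular hypergraph on the
  others, in which all edges have size \<open>k\<close> except possibly one, which is filled up with vertices of the
  clique. By linearity the edges at a vertex outside the clique form a sunflower, so any new edge
  through it completes a Berge star. The linear hypergraph is a bipartite graph without 4-cycles and
  with prescribed degrees. A largest such graph respecting the degree bounds attains them: if \<open>v\<close>
  and \<open>e\<close> both miss an incidence, replacing an incidence \<open>(x, f)\<close> far from both by \<open>(v, f)\<close> and
  \<open>(x, e)\<close> gives a larger one.
\<close>

section \<open>Linear bipartite incidence relations with prescribed degrees\<close>

lemma sum_card_swap:
  assumes "finite A" "finite B"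
  shows "(\<Sum>a\<in>A. card {b\<in>B. R a b}) = (\<Sum>b\<in>B. card {a\<in>A. R a b})"
  using sum.swap_restrict[OF assms, of "\<lambda>_ _. 1::nat" R] by simp

text \<open>Edges are indices in \<open>M\<close> rather than vertex sets, so the relation is a
  bipartite graph; the last clause forbids its 4-cycles, which is linearity. The degrees are only
  bounded from above, so that the empty relation qualifies and a largest one can be taken.\<close>

definition partial_incidence ::
    "'a set \<Rightarrow> 'b set \<Rightarrow> nat \<Rightarrow> ('b \<Rightarrow> nat) \<Rightarrow> ('a \<times> 'b) set \<Rightarrow> bool" where
  "partial_incidence W M d c I \<longleftrightarrow>
     I \<subseteq> W \<times> M \<and> (\<forall>w\<in>W. card {e. (w, e) \<in> I} \<le> d) \<and> (\<forall>e\<in>M. card {w. (w, e) \<in> I} \<le> c e) \<and>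
     (\<forall>w x e f. (w, e) \<in> I \<longrightarrow> (w, f) \<in> I \<longrightarrow> (x, e) \<in> I \<longrightarrow> (x, f) \<in> I \<longrightarrow> w = x \<or> e = f)"

lemma card_UN_le_mult:
  assumes "finite A" "card A \<le> m" "\<And>a. a \<in> A \<Longrightarrow> card (B a) \<le> b"
  shows "card (\<Union>a\<in>A. B a) \<le> m * b"
proof -
  have "card (\<Union>a\<in>A. B a) \<le> (\<Sum>a\<in>A. card (B a))"
    by (rule card_UN_le[OF assms(1)])
  also have "\<dots> \<le> card A * b"
    using sum_bounded_above[of A "\<lambda>a. card (B a)" b] assms(3) by simp
  also have "\<dots> \<le> m * b" using assms(2) by simp
  finally show ?thesis .
qed

lemma card_incidence_rows:
  assumes "finite W" "finite M" "I \<subseteq> W \<times> M"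
  shows "card I = (\<Sum>w\<in>W. card {e. (w, e) \<in> I})"
proof -
  have "I = (SIGMA w:W. {e. (w, e) \<in> I})" using assms(3) by auto
  moreover have "finite {e. (w, e) \<in> I}" for w
    using assms by (auto intro: finite_subset[of _ M])
  ultimately show ?thesis using card_SigmaI[OF assms(1), of "\<lambda>w. {e. (w, e) \<in> I}"] by simp
qed

lemma card_incidence_cols:
  assumes "finite W" "finite M" "I \<subseteq> W \<times> M"
  shows "card I = (\<Sum>e\<in>M. card {w. (w, e) \<in> I})"
proof -
  have "card I = card (I\<inverse>)" by simp
  also have "\<dots> = (\<Sum>e\<in>M. card {w. (w, e) \<in> I})"
    using card_incidence_rows[OF assms(2,1), of "I\<inverse>"] assms(3) by auto
  finally show ?thesis .
qed

text \<open>Vertex \<open>x\<close> and edge \<open>f\<close> each lose one incidence and gain one,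
  so only the degrees of \<open>v\<close> and \<open>e\<close> grow, and both have room. The
  conditions \<open>far1\<close> and \<open>far2\<close> exclude the paths of length 3 that a new
  incidence could close to a 4-cycle.\<close>

lemma partial_incidence_switch:
  assumes I: "partial_incidence W M d c I" and fin: "finite W" "finite M"
    and v: "v \<in> W" "card {e. (v, e) \<in> I} < d" and e: "e \<in> M" "card {w. (w, e) \<in> I} < c e"
    and xf: "(x, f) \<in> I"
    and far1: "\<And>g w. (v, g) \<in> I \<Longrightarrow> (w, g) \<in> I \<Longrightarrow> (w, f) \<notin> I"
    and far2: "\<And>g w. (w, e) \<in> I \<Longrightarrow> (w, g) \<in> I \<Longrightarrow> (x, g) \<notin> I"
  defines "J \<equiv> insert (v, f) (insert (x, e) (I - {(x, f)}))"
  shows "partial_incidence W M d c J \<and> card J = Suc (card I)"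
proof -
  have sub: "I \<subseteq> W \<times> M" and degW: "\<And>w. w \<in> W \<Longrightarrow> card {e. (w, e) \<in> I} \<le> d"
    and degM: "\<And>e. e \<in> M \<Longrightarrow> card {w. (w, e) \<in> I} \<le> c e"
    and lin: "\<And>w x e f. (w, e) \<in> I \<Longrightarrow> (w, f) \<in> I \<Longrightarrow> (x, e) \<in> I \<Longrightarrow> (x, f) \<in> I \<Longrightarrow> w = x \<or> e = f"
    using I unfolding partial_incidence_def by blast+
  have finI: "finite I" using sub fin finite_subset by blast
  \<comment> \<open>The degenerate paths are covered too: here \<open>g = f\<close>,
    \<open>w = v\<close>, and in the next line \<open>w = x\<close>, \<open>g = e\<close>.\<close>
  have vf: "(v, f) \<notin> I" using far1 by blast
  have xe: "(x, e) \<notin> I" using far2 by blast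
  have ne: "v \<noteq> x" "e \<noteq> f" using vf xe xf by auto
  have inW: "x \<in> W" "f \<in> M" using xf sub by auto
  have finr: "finite {e. (w, e) \<in> I}" for w using sub fin by (auto intro: finite_subset[of _ M])
  have finc: "finite {w. (w, e) \<in> I}" for e using sub fin by (auto intro: finite_subset[of _ W])
  have "card (insert (x, e) (I - {(x, f)})) = card I"
    using xe xf finI card_Suc_Diff1 by fastforce
  then have cardJ: "card J = Suc (card I)"
    using vf ne finI unfolding J_def by simp
  have JW: "card {e. (w, e) \<in> J} \<le> d" if "w \<in> W" for w
  proof -
    consider "w = v" | "w = x" | "w \<noteq> v" "w \<noteq> x" by blast
    then show ?thesis
    proof cases
      case 1
      then have "{e. (w, e) \<in> J} = insert f {e. (v, e) \<in> I}" using ne by (auto simp: J_def)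
      then show ?thesis using v(2) finr[of v] by (simp add: card_insert_if)
    next
      case 2
      then have "{e. (w, e) \<in> J} = insert e ({e. (x, e) \<in> I} - {f})" using ne by (auto simp: J_def)
      moreover have "card (insert e ({e. (x, e) \<in> I} - {f})) = card {e. (x, e) \<in> I}"
        using xe xf finr[of x] card_Suc_Diff1[OF finr[of x], of f] by simp
      ultimately show ?thesis using degW[OF inW(1)] by simp
    next
      case 3
      then have "{e. (w, e) \<in> J} = {e. (w, e) \<in> I}" by (auto simp: J_def)
      then show ?thesis using degW[OF that] by simp
    qed
  qed
  have JM: "card {w. (w, g) \<in> J} \<le> c g" if "g \<in> M" for g
  proof -
    consider "g = e" | "g = f" | "g \<noteq> e" "g \<noteq> f" by blast
    then show ?thesis
    proof cases
      case 1
      then have "{w. (w, g) \<in> J} = insert x {w. (w, e) \<in> I}" using ne by (auto simp: J_def)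
      then show ?thesis using e(2) finc[of e] 1 by (simp add: card_insert_if)
    next
      case 2
      then have "{w. (w, g) \<in> J} = insert v ({w. (w, f) \<in> I} - {x})" using ne by (auto simp: J_def)
      moreover have "card (insert v ({w. (w, f) \<in> I} - {x})) = card {w. (w, f) \<in> I}"
        using vf xf finc[of f] card_Suc_Diff1[OF finc[of f], of x] by simp
      ultimately show ?thesis using degM[OF inW(2)] 2 by simp
    next
      case 3
      then have "{w. (w, g) \<in> J} = {w. (w, g) \<in> I}" by (auto simp: J_def)
      then show ?thesis using degM[OF that] by simp
    qed
  qed
  have J_iff: "(w, g) \<in> J \<longleftrightarrow> w = v \<and> g = f \<or> w = x \<and> g = e \<or> (w, g) \<in> I \<and> \<not> (w = x \<and> g = f)"
    for w g by (auto simp: J_def)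
  \<comment> \<open>A path of length 3 in \<open>J\<close> that closes a cycle with one new
    incidence could contain the other only as its middle step, and then it would also contain the
    deleted \<open>(x, f)\<close>. So the path lies in \<open>I\<close>.\<close>
  have vf_far: "y = v \<or> h = f" if "(v, h) \<in> J" "(y, f) \<in> J" "(y, h) \<in> J" for y h
    using that far1[of h y] ne unfolding J_iff by blast
  have xe_far: "y = x \<or> h = e" if "(x, h) \<in> J" "(y, e) \<in> J" "(y, h) \<in> J" for y h
    using that far2[of y h] ne unfolding J_iff by blast
  have Jlin: "w = y \<or> g = h"
    if J: "(w, g) \<in> J" "(w, h) \<in> J" "(y, g) \<in> J" "(y, h) \<in> J" for w y g h
  proof -
    have J_cases: "(w, g) \<in> I \<or> v = w \<and> f = g \<or> x = w \<and> e = g" if "(w, g) \<in> J" for w g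
      using that unfolding J_iff by auto
    \<comment> \<open>Either all four incidences are old, or one of the four is one of the two new
      ones.\<close>
    consider "(w, g) \<in> I" "(w, h) \<in> I" "(y, g) \<in> I" "(y, h) \<in> I"
      | "v = w" "f = g" | "v = w" "f = h" | "v = y" "f = g" | "v = y" "f = h"
      | "x = w" "e = g" | "x = w" "e = h" | "x = y" "e = g" | "x = y" "e = h"
      using J_cases[OF J(1)] J_cases[OF J(2)] J_cases[OF J(3)] J_cases[OF J(4)] by argo
    then show ?thesis
    proof cases
      case 1 then show ?thesis by (rule lin)
    next
      case 2 then show ?thesis using vf_far[of h y] J by auto
    next
      case 3 then show ?thesis using vf_far[of g y] J by auto
    next
      case 4 then show ?thesis using vf_far[of h w] J by auto
    next
      case 5 then show ?thesis using vf_far[of g w] J by auto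
    next
      case 6 then show ?thesis using xe_far[of h y] J by auto
    next
      case 7 then show ?thesis using xe_far[of g y] J by auto
    next
      case 8 then show ?thesis using xe_far[of h w] J by auto
    next
      case 9 then show ?thesis using xe_far[of g w] J by auto
    qed
  qed
  show ?thesis
    unfolding partial_incidence_def
  proof (intro conjI ballI allI impI)
    show "J \<subseteq> W \<times> M" using sub v(1) e(1) inW by (auto simp: J_def)
  qed (fact JW JM cardJ Jlin)+
qed

text \<open>By \<open>sum_c\<close> both sides demand the same total, so a largest relation that
  falls short has both a deficient vertex and a deficient edge. With more than \<open>?C\<close>
  incidences a switch enlarges it; with at most \<open>?C\<close>, some vertex and some edge are
  still untouched and can be joined. One factor \<open>k\<close> in \<open>large\<close> pays for
  passing from \<open>card W\<close> to \<open>card M\<close>.\<close>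

lemma exists_linear_incidence:
  assumes fin: "finite W" "finite M" and d: "d \<ge> 1" and k: "k \<ge> 1"
    and c: "\<And>e. e \<in> M \<Longrightarrow> 1 \<le> c e \<and> c e \<le> k" and sum_c: "sum c M = d * card W"
    and large: "card W > 2 * k ^ 3 * d ^ 2"
  obtains I where "I \<subseteq> W \<times> M" "\<And>w. w \<in> W \<Longrightarrow> card {e. (w, e) \<in> I} = d"
    "\<And>e. e \<in> M \<Longrightarrow> card {w. (w, e) \<in> I} = c e"
    "\<And>w x e f. (w, e) \<in> I \<Longrightarrow> (w, f) \<in> I \<Longrightarrow> (x, e) \<in> I \<Longrightarrow> (x, f) \<in> I \<Longrightarrow> w = x \<or> e = f"
proof -
  let ?P = "partial_incidence W M d c"
  let ?C = "2 * k ^ 2 * d ^ 2"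
  have "?P {}" by (simp add: partial_incidence_def)
  moreover have "\<forall>J. ?P J \<longrightarrow> card J < Suc (card (W \<times> M))"
    using fin card_mono[of "W \<times> M"]
    by (simp add: partial_incidence_def less_Suc_eq_le del: card_cartesian_product)
  ultimately have "\<exists>I. ?P I \<and> (\<forall>J. ?P J \<longrightarrow> card J \<le> card I)"
    by (rule ex_has_greatest_nat)
  then obtain I where I: "?P I" and "\<forall>J. ?P J \<longrightarrow> card J \<le> card I" by (elim exE conjE)
  then have max: "card J \<le> card I" if "?P J" for J using that by simp
  have sub: "I \<subseteq> W \<times> M" and degW: "\<And>w. w \<in> W \<Longrightarrow> card {e. (w, e) \<in> I} \<le> d"
    and degM: "\<And>e. e \<in> M \<Longrightarrow> card {w. (w, e) \<in> I} \<le> c e"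
    and lin: "\<And>w x e f. (w, e) \<in> I \<Longrightarrow> (w, f) \<in> I \<Longrightarrow> (x, e) \<in> I \<Longrightarrow> (x, f) \<in> I \<Longrightarrow> w = x \<or> e = f"
    using I unfolding partial_incidence_def by blast+
  note rows = card_incidence_rows[OF fin sub] and cols = card_incidence_cols[OF fin sub]
  have finI: "finite I" using sub fin finite_subset by blast
  have finr: "finite {e. (w, e) \<in> I}" for w using sub fin by (auto intro: finite_subset[of _ M])
  have finc: "finite {w. (w, e) \<in> I}" for e using sub fin by (auto intro: finite_subset[of _ W])
  have dr: "card {e. (w, e) \<in> I} \<le> d" for w
  proof (cases "w \<in> W")
    case False
    then have "{e. (w, e) \<in> I} = {}" using sub by auto
    then show ?thesis by simp
  qed (rule degW)
  have dc: "card {w. (w, e) \<in> I} \<le> k" for e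
  proof (cases "e \<in> M")
    case True
    then show ?thesis using degM c by (meson le_trans)
  next
    case False
    then have "{w. (w, e) \<in> I} = {}" using sub by auto
    then show ?thesis by simp
  qed
  \<comment> \<open>Attaining the total suffices: every degree is bounded by its target, so equality
    of the sums forces equality in each term.\<close>
  have full: "card I = d * card W"
  proof (rule ccontr)
    assume "card I \<noteq> d * card W"
    moreover have "card I \<le> d * card W"
      unfolding rows using sum_bounded_above[of W _ d] dr by (simp add: mult.commute)
    ultimately have less: "card I < d * card W" by simp
    obtain v where v: "v \<in> W" "card {e. (v, e) \<in> I} < d"
    proof -
      have "\<not> (\<forall>w\<in>W. d \<le> card {e. (w, e) \<in> I})"
        using less sum_bounded_below[of W d "\<lambda>w. card {e. (w, e) \<in> I}"] unfolding rows
        by (auto simp: mult.commute)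
      then show ?thesis using that by auto
    qed
    obtain e where e: "e \<in> M" "card {w. (w, e) \<in> I} < c e"
    proof -
      have "\<not> (\<forall>e\<in>M. c e \<le> card {w. (w, e) \<in> I})"
        using less sum_mono[of M c "\<lambda>e. card {w. (w, e) \<in> I}"] unfolding cols sum_c[symmetric]
        by auto
      then show ?thesis using that by auto
    qed
    show False
    proof (cases "card I \<le> ?C")
      case True
      have le: "?C \<le> 2 * k ^ 3 * d ^ 2" using k by (simp add: power_increasing)
      have "card (fst ` I) < card W"
        using card_image_le[OF finI, of fst] True large le by linarith
      then obtain w where w: "w \<in> W" "w \<notin> fst ` I"
        using finI by (metis card_mono finite_imageI not_less subsetI)
      \<comment> \<open>Edges have target size at most \<open>k\<close>, so
        \<open>k * card M\<close> is at least the total demand \<open>d * card W\<close>.\<close>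
      have "k * ?C < k * card M"
      proof -
        have "k * ?C = 2 * k ^ 3 * d ^ 2" by (simp add: power2_eq_square power3_eq_cube)
        also have "\<dots> < card W" by (rule large)
        also have "\<dots> \<le> d * card W" using d by simp
        also have "\<dots> \<le> k * card M"
          unfolding sum_c[symmetric] using sum_bounded_above[of M c k] c by (simp add: mult.commute)
        finally show ?thesis .
      qed
      then have "?C < card M" by simp
      then have "card (snd ` I) < card M"
        using card_image_le[OF finI, of snd] True by linarith
      then obtain g where g: "g \<in> M" "g \<notin> snd ` I"
        using finI by (metis card_mono finite_imageI not_less subsetI)
      have w': "(w, h) \<notin> I" for h using w(2) by force
      have g': "(y, g) \<notin> I" for y using g(2) by force
      let ?J = "insert (w, g) I"
      have "card {h. (y, h) \<in> ?J} \<le> d" for y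
      proof (cases "y = w")
        case True
        then have "{h. (y, h) \<in> ?J} = {g}" using w' by auto
        then show ?thesis using d by simp
      qed (use dr[of y] in simp)
      moreover have "card {y. (y, h) \<in> ?J} \<le> c h" if "h \<in> M" for h
      proof (cases "h = g")
        case True
        then have "{y. (y, h) \<in> ?J} = {w}" using g' by auto
        then show ?thesis using c[OF that] by simp
      qed (use degM[OF that] in simp)
      ultimately have "?P ?J"
        unfolding partial_incidence_def using sub w(1) g(1) lin w' g' by auto
      then show False using max[of ?J] finI w' by simp
    next
      case False
      \<comment> \<open>A new 4-cycle would need a path of length 3 from \<open>v\<close> to \<open>f\<close> or from \<open>e\<close> to \<open>x\<close>; at most
        \<open>2 k\<^sup>2 d\<^sup>2\<close> incidences \<open>(x, f)\<close> admit one.\<close>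
      define F where "F = (\<Union>g\<in>{g. (v, g) \<in> I}. \<Union>w\<in>{w. (w, g) \<in> I}. {f. (w, f) \<in> I})"
      define X where "X = (\<Union>w\<in>{w. (w, e) \<in> I}. \<Union>g\<in>{g. (w, g) \<in> I}. {x. (x, g) \<in> I})"
      have F: "card F \<le> d * (k * d)" "finite F"
        unfolding F_def using finr finc dr dc by (auto intro!: card_UN_le_mult)
      have X: "card X \<le> k * (d * k)" "finite X"
        unfolding X_def using finr finc dr dc by (auto intro!: card_UN_le_mult)
      define B where "B = (\<Union>f\<in>F. {w. (w, f) \<in> I} \<times> {f}) \<union> (\<Union>x\<in>X. {x} \<times> {f. (x, f) \<in> I})"
      have "card (\<Union>f\<in>F. {w. (w, f) \<in> I} \<times> {f}) \<le> d * (k * d) * k"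
        using F dc by (intro card_UN_le_mult) (simp_all add: card_cartesian_product)
      moreover have "card (\<Union>x\<in>X. {x} \<times> {f. (x, f) \<in> I}) \<le> k * (d * k) * d"
        using X dr by (intro card_UN_le_mult) (simp_all add: card_cartesian_product)
      ultimately have "card B \<le> d * (k * d) * k + k * (d * k) * d"
        unfolding B_def using card_Un_le[of "\<Union>f\<in>F. {w. (w, f) \<in> I} \<times> {f}" "\<Union>x\<in>X. {x} \<times> {f. (x, f) \<in> I}"]
        by linarith
      also have "\<dots> = ?C" by (simp add: power2_eq_square)
      finally have "card B < card I" using False by simp
      moreover have "finite B" unfolding B_def using F(2) X(2) finr finc by auto
      ultimately have "\<not> I \<subseteq> B" using card_mono[of B I] by linarith
      then obtain x f where xf: "(x, f) \<in> I" "(x, f) \<notin> B" by auto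
      then have "f \<notin> F" "x \<notin> X" by (auto simp: B_def)
      then have "card (insert (v, f) (insert (x, e) (I - {(x, f)}))) = Suc (card I)"
        "?P (insert (v, f) (insert (x, e) (I - {(x, f)})))"
        using partial_incidence_switch[OF I fin v e xf(1)] unfolding F_def X_def by blast+
      then show False using max by (metis Suc_n_not_le_n)
    qed
  qed
  have "card {e. (w, e) \<in> I} = d" if "w \<in> W" for w
  proof (rule ccontr)
    assume "card {e. (w, e) \<in> I} \<noteq> d"
    then have "(\<Sum>w\<in>W. card {e. (w, e) \<in> I}) < (\<Sum>w\<in>W. d)"
      using that fin dr by (intro sum_strict_mono_ex1) (auto simp: le_less)
    then show False using full rows by simp
  qed
  moreover have "card {w. (w, e) \<in> I} = c e" if "e \<in> M" for e
  proof (rule ccontr)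
    assume "card {w. (w, e) \<in> I} \<noteq> c e"
    then have "(\<Sum>e\<in>M. card {w. (w, e) \<in> I}) < sum c M"
      using that fin degM by (intro sum_strict_mono_ex1) (auto simp: le_less)
    then show False using full cols sum_c by simp
  qed
  ultimately show ?thesis using that[OF sub] lin by blast
qed

section \<open>Berge stars and vertex degrees\<close>

lemma card_subsets_containing:
  assumes "finite A" "v \<in> A" "k \<ge> 1"
  shows "card {e. e \<subseteq> A \<and> card e = k \<and> v \<in> e} = (card A - 1) choose (k - 1)"
proof -
  have "bij_betw (insert v) {e. e \<subseteq> A - {v} \<and> card e = k - 1} {e. e \<subseteq> A \<and> card e = k \<and> v \<in> e}"
  proof (rule bij_betw_byWitness[where f' = "\<lambda>e. e - {v}"])
    show "insert v ` {e. e \<subseteq> A - {v} \<and> card e = k - 1} \<subseteq> {e. e \<subseteq> A \<and> card e = k \<and> v \<in> e}"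
    proof (rule image_subsetI)
      fix e assume "e \<in> {e. e \<subseteq> A - {v} \<and> card e = k - 1}"
      then have e: "e \<subseteq> A - {v}" "card e = k - 1" by auto
      then have "finite e" "v \<notin> e" using assms(1) finite_subset by blast+
      then show "insert v e \<in> {e. e \<subseteq> A \<and> card e = k \<and> v \<in> e}" using e assms by auto
    qed
  qed (use assms in auto)
  then have "card {e. e \<subseteq> A \<and> card e = k \<and> v \<in> e} = card {e. e \<subseteq> A - {v} \<and> card e = k - 1}"
    using bij_betw_same_card by fastforce
  also have "\<dots> = card (A - {v}) choose (k - 1)" by (rule n_subsets) (use assms in auto)
  finally show ?thesis using assms by simp
qed

lemma card_star_edges: "card (star_edges l) = l"
proof -
  have "inj_on (\<lambda>i::nat. {0, i}) {1..l}" by (auto simp: inj_on_def doubleton_eq_iff)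
  then show ?thesis by (simp add: star_edges_def card_image)
qed

text \<open>The \<open>l\<close> distinct edges of a Berge star all contain the image of its
  center.\<close>

lemma contains_berge_star_degree:
  assumes "contains_berge (star_vertices l) (star_edges l) V E" "finite E"
  obtains v where "v \<in> V" "l \<le> card {e \<in> E. v \<in> e}"
proof -
  obtain \<psi> \<phi> where *: "inj_on \<psi> (star_vertices l)" "\<psi> ` star_vertices l \<subseteq> V" "inj_on \<phi> (star_edges l)"
    "\<phi> ` star_edges l \<subseteq> E" "\<forall>e\<in>star_edges l. \<psi> ` e \<subseteq> \<phi> e"
    using assms(1) unfolding contains_berge_def by (elim exE conjE)
  have "\<phi> ` star_edges l \<subseteq> {e \<in> E. \<psi> 0 \<in> e}"
    using *(4,5) by (fastforce simp: star_edges_def)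
  then have "card (\<phi> ` star_edges l) \<le> card {e \<in> E. \<psi> 0 \<in> e}"
    by (rule card_mono[rotated]) (use assms(2) in simp)
  moreover have "\<psi> 0 \<in> V" using *(2) by (auto simp: star_vertices_def)
  ultimately show ?thesis using that *(3) by (simp add: card_image card_star_edges)
qed

text \<open>A Berge star that appears only with \<open>e\<close> must use \<open>e\<close>; its
  center then lies in \<open>e\<close>, and its other \<open>l - 1\<close> edges are old.\<close>

lemma contains_berge_star_insert_degree:
  assumes "contains_berge (star_vertices l) (star_edges l) V (insert e E)"
    and "\<not> contains_berge (star_vertices l) (star_edges l) V E" and "finite E"
  obtains v where "v \<in> e" "l \<le> Suc (card {f \<in> E. v \<in> f})"
proof -
  obtain \<psi> \<phi> where *: "inj_on \<psi> (star_vertices l)" "\<psi> ` star_vertices l \<subseteq> V"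
    "inj_on \<phi> (star_edges l)" "\<phi> ` star_edges l \<subseteq> insert e E"
    "\<forall>e\<in>star_edges l. \<psi> ` e \<subseteq> \<phi> e"
    using assms(1) unfolding contains_berge_def by (elim exE conjE)
  have "\<not> \<phi> ` star_edges l \<subseteq> E"
    using assms(2) * unfolding contains_berge_def by blast
  then obtain s where s: "s \<in> star_edges l" "\<phi> s = e" using *(4) by blast
  then have "\<psi> 0 \<in> e" using *(5) s(1) by (auto simp: star_edges_def)
  have "\<psi> 0 \<in> \<phi> t" if "t \<in> star_edges l" for t
    using *(5) that by (auto simp: star_edges_def)
  then have "\<phi> ` star_edges l \<subseteq> insert e {f \<in> E. \<psi> 0 \<in> f}"
    using *(4) by auto
  then have "card (\<phi> ` star_edges l) \<le> card (insert e {f \<in> E. \<psi> 0 \<in> f})"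
    by (rule card_mono[rotated]) (use assms(3) in simp)
  also have "\<dots> \<le> Suc (card {f \<in> E. \<psi> 0 \<in> f})" using assms(3) by (simp add: card_insert_if)
  finally have "l \<le> Suc (card {f \<in> E. \<psi> 0 \<in> f})"
    using *(3) by (simp add: card_image card_star_edges)
  then show ?thesis using that \<open>\<psi> 0 \<in> e\<close> by blast
qed

text \<open>The leaf in the new edge is chosen first; the sunflower edges have two candidates each, so
  they can avoid it.\<close>

lemma contains_berge_star_sunflower:
  assumes F: "F \<subseteq> E" "finite F" "Suc (card F) = l"
    and Fe: "\<And>f. f \<in> F \<Longrightarrow> v \<in> f \<and> f \<subseteq> V \<and> card f \<ge> 3"
    and disj: "\<And>f g. f \<in> F \<Longrightarrow> g \<in> F \<Longrightarrow> f \<noteq> g \<Longrightarrow> f \<inter> g \<subseteq> {v}"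
    and e: "e \<notin> F" "v \<in> e" "e \<subseteq> V" "card e \<ge> 2"
  shows "contains_berge (star_vertices l) (star_edges l) V (insert e E)"
proof -
  obtain h where h: "bij_betw h {1..card F} F"
    using F(2) by (metis card_atLeastAtMost diff_Suc_1 finite_atLeastAtMost finite_same_card_bij)
  have "\<not> e \<subseteq> {v}" using e(4) card_mono[of "{v}" e] by auto
  then obtain x where x: "x \<in> e" "x \<noteq> v" by blast
  have "\<exists>y. y \<in> f \<and> y \<noteq> v \<and> y \<noteq> x" if "f \<in> F" for f
  proof -
    have "card {v, x} \<le> 2" by (simp add: card_insert_if)
    then have "\<not> f \<subseteq> {v, x}" using card_mono[of "{v, x}" f] Fe[OF that] by auto
    then show ?thesis by blast
  qed
  then obtain y where y: "\<And>f. f \<in> F \<Longrightarrow> y f \<in> f \<and> y f \<noteq> v \<and> y f \<noteq> x" by metis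
  have hF: "h i \<in> F" if "1 \<le> i" "i < l" for i
    using bij_betwE[OF h] that F(3) by auto
  have hinj: "i = j" if "h i = h j" "1 \<le> i" "i < l" "1 \<le> j" "j < l" for i j
    using bij_betw_imp_inj_on[OF h] that F(3) by (auto dest: inj_onD)
  \<comment> \<open>Distinct petals meet only in \<open>v\<close>, so leaves chosen off
    \<open>v\<close> are automatically distinct.\<close>
  have yinj: "f = g" if "f \<in> F" "g \<in> F" "y f = y g" for f g
    using disj[of f g] y[of f] y[of g] that by auto
  define \<psi> where "\<psi> i = (if i = 0 then v else if i = l then x else y (h i))" for i
  \<comment> \<open>\<open>Max\<close> recovers the leaf \<open>i\<close> from the star edge
    \<open>{0, i}\<close>; leaf \<open>l\<close> is assigned the new edge.\<close>
  define \<phi> where "\<phi> s = (if Max s = l then e else h (Max s))" for s :: "nat set"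
  have l: "l \<ge> 1" using F(3) by simp
  have \<psi>_0: "\<psi> 0 = v" and \<psi>_l: "\<psi> l = x" using l by (auto simp: \<psi>_def)
  have \<psi>_h: "\<psi> i = y (h i)" if "1 \<le> i" "i < l" for i using that by (simp add: \<psi>_def)
  have \<psi>_ne_x: "\<psi> i \<noteq> x" if "1 \<le> i" "i < l" for i
    using y[OF hF[OF that]] \<psi>_h[OF that] by simp
  have \<psi>_ne_v: "\<psi> i \<noteq> v" if "1 \<le> i" "i \<le> l" for i
    using y[OF hF, of i] \<psi>_h[of i] \<psi>_l x(2) that by (cases "i = l") auto
  have "inj_on \<psi> (star_vertices l)"
  proof (rule linorder_inj_onI')
    fix i j assume "i \<in> star_vertices l" "j \<in> star_vertices l" "i < j"
    then have ij: "i < j" "j \<le> l" by (auto simp: star_vertices_def)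
    consider "i = 0" | "1 \<le> i" "j = l" | "1 \<le> i" "j < l" using ij by linarith
    then show "\<psi> i \<noteq> \<psi> j"
    proof cases
      case 1
      then show ?thesis using \<psi>_0 \<psi>_ne_v[of j] ij by simp
    next
      case 2
      then show ?thesis using \<psi>_l \<psi>_ne_x[of i] ij by simp
    next
      case 3
      then have "h i \<noteq> h j" using hinj[of i j] ij by auto
      then show ?thesis using 3 ij yinj[OF hF hF, of i j] \<psi>_h[of i] \<psi>_h[of j] by auto
    qed
  qed
  moreover have "\<psi> i \<in> V" if "i \<le> l" for i
    using that hF[of i] y[of "h i"] Fe[of "h i"] x e by (auto simp: \<psi>_def)
  then have "\<psi> ` star_vertices l \<subseteq> V" by (auto simp: star_vertices_def)
  moreover have \<phi>: "\<phi> {0, i} = (if i = l then e else h i)" for i by (simp add: \<phi>_def)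
  have "inj_on \<phi> (star_edges l)"
  proof (rule inj_onI)
    fix s t assume st: "s \<in> star_edges l" "t \<in> star_edges l" "\<phi> s = \<phi> t"
    then obtain i j where ij: "s = {0, i}" "t = {0, j}" "1 \<le> i" "i \<le> l" "1 \<le> j" "j \<le> l"
      by (auto simp: star_edges_def)
    have "i = j"
      using st(3) ij hF[of i] hF[of j] e(1) hinj[of i j] unfolding ij(1,2) \<phi>
      by (auto split: if_splits)
    then show "s = t" using ij by simp
  qed
  moreover have "\<phi> {0, i} \<in> insert e E" if "1 \<le> i" "i \<le> l" for i
    using hF[of i] F(1) that by (auto simp: \<phi>)
  then have "\<phi> ` star_edges l \<subseteq> insert e E"
    unfolding star_edges_def image_image by (intro image_subsetI) simp
  moreover have "\<psi> ` s \<subseteq> \<phi> s" if "s \<in> star_edges l" for s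
  proof -
    obtain i where i: "s = {0, i}" "1 \<le> i" "i \<le> l" using \<open>s \<in> star_edges l\<close> by (auto simp: star_edges_def)
    show ?thesis unfolding i(1) \<phi> using i(2,3) hF[of i] Fe[of "h i"] y[of "h i"] e(2) x
      by (auto simp: \<psi>_def)
  qed
  ultimately show ?thesis unfolding contains_berge_def by blast
qed

section \<open>The lower bound\<close>

text \<open>Here \<open>a\<close> is the number of low-degree vertices, which form a clique. Edges
  inside the clique are counted exactly; each other edge supplies at most \<open>k\<close> of the
  incidences demanded outside it. The inequality is kept multiplied by \<open>k\<close>, and
  rounding is left to the final theorem.\<close>

lemma berge_star_saturated_card_ge:
  assumes sat: "berge_saturated (star_vertices l) (star_edges l) k V E" and k: "k \<ge> 1"
  obtains a where "a \<le> card V" "a = 0 \<or> (a - 1) choose (k - 1) \<le> l - 2"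
    "(l - 1) * (card V - a) + k * (a choose k) \<le> k * card E"
proof -
  have fV: "finite V" and Ek: "\<And>e. e \<in> E \<Longrightarrow> e \<subseteq> V \<and> card e = k"
    and free: "\<not> contains_berge (star_vertices l) (star_edges l) V E"
    and add: "\<And>e. e \<subseteq> V \<Longrightarrow> card e = k \<Longrightarrow> e \<notin> E \<Longrightarrow>
      contains_berge (star_vertices l) (star_edges l) V (insert e E)"
    using sat unfolding berge_saturated_def uniform_hypergraph_def by blast+
  have fE: "finite E" using Ek fV by (intro finite_subset[of E "Pow V"]) auto
  \<comment> \<open>Written with \<open>Suc\<close> because \<open>l - 2\<close> truncates to 0 at
    \<open>l = 1\<close>, which would admit vertices of degree 0; this \<open>A\<close> is empty for
    \<open>l\<close> at most 1.\<close>
  define A where "A = {v \<in> V. Suc (card {e \<in> E. v \<in> e}) < l}"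
  have AV: "A \<subseteq> V" and fA: "finite A" using fV by (auto simp: A_def)
  have clique: "e \<in> E" if "e \<subseteq> A" "card e = k" for e
  proof (rule ccontr)
    assume "e \<notin> E"
    then have "contains_berge (star_vertices l) (star_edges l) V (insert e E)"
      using add that AV by blast
    then obtain v where "v \<in> e" "l \<le> Suc (card {f \<in> E. v \<in> f})"
      using contains_berge_star_insert_degree free fE by blast
    then show False using that by (auto simp: A_def)
  qed
  have small: "(card A - 1) choose (k - 1) \<le> l - 2" if "A \<noteq> {}"
  proof -
    obtain v where v: "v \<in> A" using \<open>A \<noteq> {}\<close> by blast
    have "(card A - 1) choose (k - 1) = card {e. e \<subseteq> A \<and> card e = k \<and> v \<in> e}"
      using card_subsets_containing[OF fA v k] by simp
    also have "\<dots> \<le> card {e \<in> E. v \<in> e}" using clique fE by (intro card_mono) auto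
    also have "\<dots> \<le> l - 2" using v by (auto simp: A_def)
    finally show ?thesis .
  qed
  let ?in = "{e \<in> E. e \<subseteq> A}" and ?out = "{e \<in> E. \<not> e \<subseteq> A}"
  have "?in = {e. e \<subseteq> A \<and> card e = k}" using clique Ek by auto
  then have card_in: "card ?in = card A choose k" using n_subsets[OF fA] by simp
  have "E = ?in \<union> ?out" by auto
  then have split: "card E = card ?in + card ?out"
    using fE card_Un_disjoint[of ?in ?out] by auto
  have "(l - 1) * card (V - A) \<le> (\<Sum>v\<in>V - A. card {e \<in> E. v \<in> e})"
    using sum_bounded_below[of "V - A" "l - 1" "\<lambda>v. card {e \<in> E. v \<in> e}"]
    by (force simp: A_def mult.commute)
  also have "\<dots> = (\<Sum>e\<in>E. card {v \<in> V - A. v \<in> e})"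
    using fV fE by (intro sum_card_swap) auto
  \<comment> \<open>Edges inside \<open>A\<close> have no vertex in \<open>V - A\<close>.\<close>
  also have "\<dots> = (\<Sum>e\<in>?out. card {v \<in> V - A. v \<in> e})"
  proof (intro sum.mono_neutral_right ballI)
    fix e assume "e \<in> E - ?out"
    then have "{v \<in> V - A. v \<in> e} = {}" by auto
    then show "card {v \<in> V - A. v \<in> e} = 0" by (simp only: card.empty)
  qed (use fE in auto)
  also have "\<dots> \<le> card ?out * k"
  proof -
    have "card {v \<in> V - A. v \<in> e} \<le> k" if "e \<in> ?out" for e
      using that Ek[of e] fV finite_subset[of e V] card_mono[of e "{v \<in> V - A. v \<in> e}"] by auto
    then show ?thesis using sum_bounded_above[of ?out _ k] by simp
  qed
  finally have "(l - 1) * (card V - card A) \<le> card ?out * k"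
    using AV fA by (simp add: card_Diff_subset)
  then have "(l - 1) * (card V - card A) + k * (card A choose k) \<le> k * card E"
    unfolding split card_in by (simp add: algebra_simps)
  moreover have "card A = 0 \<or> (card A - 1) choose (k - 1) \<le> l - 2" using small by fastforce
  ultimately show ?thesis using that[of "card A"] AV fV card_mono by blast
qed

section \<open>The construction for the upper bound\<close>

lemma sum_min_chunks: "(\<Sum>i<j. min k (t - k * i)) = min (k * j) (t :: nat)"
  by (induction j) (auto simp: min_def algebra_simps)

text \<open>The bound \<open>k - 1 \<le> a\<close> gives room to fill up the short edge, and the
  binomial bound leaves each clique vertex one free place below degree \<open>l\<close>, which that
  edge may take. The bound on \<open>n\<close> is what \<open>exists_linear_incidence\<close>
  requires of the vertices outside the clique.\<close>

lemma exists_berge_star_saturated: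
  assumes k: "k \<ge> 3" and l: "l \<ge> 2" and a: "k - 1 \<le> a" "(a - 1) choose (k - 1) \<le> l - 2"
    and n: "n > a + 2 * k ^ 3 * (l - 1) ^ 2"
  obtains E where "berge_saturated (star_vertices l) (star_edges l) k {..<n} E"
    "card E = ((l - 1) * (n - a) + (k - 1)) div k + (a choose k)"
proof -
  define t where "t = (l - 1) * (n - a)"
  define m where "m = (t + (k - 1)) div k"
  \<comment> \<open>The \<open>t\<close> incidences outside the clique are cut into \<open>m\<close>
    blocks, all of size \<open>k\<close> except possibly the last, which takes the remainder;
    \<open>c i\<close> is the size of block \<open>i\<close>.\<close>
  define c where "c i = min k (t - k * i)" for i
  define A where "A = {..<a}"
  define W where "W = {a..<n}"
  have fin: "finite A" "finite W" by (auto simp: A_def W_def)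
  have AW: "A \<inter> W = {}" "A \<union> W = {..<n}" using n by (auto simp: A_def W_def)
  have m_less: "i < m \<longleftrightarrow> k * i < t" for i
  proof -
    have "i < m \<longleftrightarrow> Suc i \<le> (t + (k - 1)) div k" by (simp add: m_def Suc_le_eq)
    also have "\<dots> \<longleftrightarrow> Suc i * k \<le> t + (k - 1)" using k by (intro less_eq_div_iff_mult_less_eq) simp
    also have "\<dots> \<longleftrightarrow> k * i < t" using k by (auto simp: algebra_simps)
    finally show ?thesis .
  qed
  have c_bounds: "1 \<le> c i" "c i \<le> k" if "i < m" for i
    using that k by (auto simp: c_def m_less)
  \<comment> \<open>Only the last edge can need filling up. This gives injectivity of
    \<open>g\<close>, the degrees in the clique and the disjointness of the fillings.\<close>
  have short: "Suc i = m" if "i < m" "c i < k" for i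
  proof -
    have "\<not> k * Suc i < t" using that(2) by (auto simp: c_def min_def split: if_splits)
    then show ?thesis using that(1) m_less[of "Suc i"] by linarith
  qed
  have "t \<le> k * m" using m_less[of m] by simp
  then have sum_c: "sum c {..<m} = (l - 1) * card W"
    unfolding c_def sum_min_chunks by (simp add: W_def t_def)
  have large: "card W > 2 * k ^ 3 * (l - 1) ^ 2" using n by (simp add: W_def)
  have pos: "1 \<le> l - 1" "1 \<le> k" and c: "\<And>i. i \<in> {..<m} \<Longrightarrow> 1 \<le> c i \<and> c i \<le> k"
    using k l c_bounds by auto
  obtain I where I: "I \<subseteq> W \<times> {..<m}"
    "\<And>w. w \<in> W \<Longrightarrow> card {i. (w, i) \<in> I} = l - 1"
    "\<And>i. i \<in> {..<m} \<Longrightarrow> card {w. (w, i) \<in> I} = c i"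
    and lin: "\<And>w x i j. (w, i) \<in> I \<Longrightarrow> (w, j) \<in> I \<Longrightarrow> (x, i) \<in> I \<Longrightarrow> (x, j) \<in> I \<Longrightarrow> w = x \<or> i = j"
    by (rule exists_linear_incidence[OF fin(2) finite_lessThan pos c sum_c large]) (assumption, rule that)
  define core where "core i = {w. (w, i) \<in> I}" for i
  \<comment> \<open>The filling is an initial segment of the clique \<open>{..<a}\<close>, and is
    empty when \<open>c i = k\<close>.\<close>
  define g where "g i = core i \<union> {..<k - c i}" for i
  have core: "core i \<subseteq> W" "finite (core i)" for i
    using I(1) fin(2) by (auto simp: core_def intro: finite_subset[of _ W])
  have card_core: "card (core i) = c i" if "i < m" for i using I(3) that by (simp add: core_def)
  have pad: "{..<k - c i} \<subseteq> A" if "i < m" for i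
    using c_bounds(1)[OF that] a(1) by (auto simp: A_def)
  have g_W: "g i \<inter> W = core i" if "i < m" for i
    using core(1)[of i] pad[OF that] AW unfolding g_def by blast
  have g_A: "g i \<inter> A = {..<k - c i}" if "i < m" for i
    using core(1)[of i] pad[OF that] AW unfolding g_def by blast
  have g_sub: "g i \<subseteq> {..<n}" if "i < m" for i
    using core(1)[of i] pad[OF that] AW unfolding g_def by blast
  have card_g: "card (g i) = k" if "i < m" for i
  proof -
    have "core i \<inter> {..<k - c i} = {}" using core pad[OF that] AW(1) by blast
    then have "card (g i) = c i + (k - c i)"
      using core(2) card_core[OF that] unfolding g_def by (simp add: card_Un_disjoint)
    then show ?thesis using c_bounds(2)[OF that] by simp
  qed
  have mem_g: "v \<in> g i \<longleftrightarrow> (v, i) \<in> I" if "v \<in> W" "i < m" for v i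
    using g_W[OF that(2)] that(1) by (auto simp: core_def)
  have core_inter: "core i \<inter> core j \<subseteq> {v}" if "i \<noteq> j" "v \<in> core i" "v \<in> core j" for i j v
  proof
    fix x assume "x \<in> core i \<inter> core j"
    then show "x \<in> {v}" using lin[of v i j x] that by (auto simp: core_def)
  qed
  \<comment> \<open>Two equal edges have equal cores, and linearity reduces such a core to one
    vertex. Then both edges are short, so both indices are the last one.\<close>
  have g_inj: "inj_on g {..<m}"
  proof (rule inj_onI, rule ccontr)
    fix i j assume ij: "i \<in> {..<m}" "j \<in> {..<m}" "g i = g j" "i \<noteq> j"
    then have eq: "core i = core j" using g_W[of i] g_W[of j] by simp
    have "core i \<noteq> {}" using card_core[of i] c_bounds(1)[of i] ij(1) by auto
    then obtain v where v: "v \<in> core i" by blast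
    then have "core i \<subseteq> {v}" using core_inter[OF ij(4) v] eq by auto
    then have "c i \<le> 1" using card_mono[of "{v}" "core i"] card_core[of i] ij(1) by simp
    moreover have "c j = c i" using card_core[of i] card_core[of j] ij(1,2) eq by simp
    ultimately have "Suc i = m" "Suc j = m" using short[of i] short[of j] ij(1,2) k by auto
    then show False using ij(4) by simp
  qed
  define Q where "Q = {e. e \<subseteq> A \<and> card e = k}"
  define E where "E = g ` {..<m} \<union> Q"
  have finQ: "finite Q" using fin(1) by (simp add: Q_def)
  have finE: "finite E" using finQ by (simp add: E_def)
  have "g i \<notin> Q" if "i < m" for i
  proof -
    have "core i \<noteq> {}" using card_core[OF that] c_bounds(1)[OF that] by auto
    then show ?thesis using g_W[OF that] AW(1) by (auto simp: Q_def)
  qed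
  then have "g ` {..<m} \<inter> Q = {}" by auto
  then have card_E: "card E = m + (a choose k)"
    unfolding E_def using finQ n_subsets[OF fin(1), of k] g_inj
    by (simp add: card_Un_disjoint card_image Q_def A_def)
  have Ek: "e \<subseteq> {..<n} \<and> card e = k" if "e \<in> E" for e
    using that g_sub card_g AW(2) by (auto simp: E_def Q_def)
  have star_W: "{e \<in> E. v \<in> e} = g ` {i. (v, i) \<in> I}" if "v \<in> W" for v
    using that mem_g[OF that] AW(1) I(1) by (auto simp: E_def Q_def)
  have idx: "{i. (v, i) \<in> I} \<subseteq> {..<m}" for v using I(1) by auto
  have deg_W: "card {e \<in> E. v \<in> e} = l - 1" if "v \<in> W" for v
    unfolding star_W[OF that] using I(2)[OF that] inj_on_subset[OF g_inj idx]
    by (simp add: card_image)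
  have deg_A: "card {e \<in> E. v \<in> e} \<le> l - 1" if "v \<in> A" for v
  proof -
    \<comment> \<open>Besides the clique edges, a clique vertex lies in at most the last
      edge.\<close>
    have "Suc i = m" if "i < m" "v \<in> g i" for i
      using g_A[OF that(1)] that \<open>v \<in> A\<close> short[OF that(1)] by (cases "c i < k") auto
    then have "{e \<in> E. v \<in> e} \<subseteq> insert (g (m - 1)) {e. e \<subseteq> A \<and> card e = k \<and> v \<in> e}"
      by (force simp: E_def Q_def)
    then have "card {e \<in> E. v \<in> e} \<le> card (insert (g (m - 1)) {e. e \<subseteq> A \<and> card e = k \<and> v \<in> e})"
      using fin(1) by (intro card_mono) simp_all
    also have "\<dots> \<le> Suc (card {e. e \<subseteq> A \<and> card e = k \<and> v \<in> e})"
      using fin(1) by (simp add: card_insert_if)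
    also have "\<dots> = Suc ((a - 1) choose (k - 1))"
      using card_subsets_containing[OF fin(1) that, of k] k by (simp add: A_def)
    also have "\<dots> \<le> l - 1" using a(2) l by simp
    finally show ?thesis .
  qed
  have "\<not> contains_berge (star_vertices l) (star_edges l) {..<n} E"
  proof
    assume "contains_berge (star_vertices l) (star_edges l) {..<n} E"
    from contains_berge_star_degree[OF this finE]
    obtain v where "v \<in> {..<n}" "l \<le> card {e \<in> E. v \<in> e}" by blast
    moreover from this(1) have "v \<in> A \<or> v \<in> W" using AW(2) by blast
    then have "card {e \<in> E. v \<in> e} \<le> l - 1" using deg_A[of v] deg_W[of v] by (elim disjE) simp_all
    ultimately show False using l by linarith
  qed
  moreover have "contains_berge (star_vertices l) (star_edges l) {..<n} (insert e E)"
    if e: "e \<subseteq> {..<n}" "card e = k" "e \<notin> E" for e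
  proof -
    \<comment> \<open>All \<open>k\<close>-subsets of the clique are present, so a missing edge
      contains a vertex of \<open>W\<close>, whose \<open>l - 1\<close> edges are the petals of the
      sunflower.\<close>
    have "\<not> e \<subseteq> A" using e by (auto simp: E_def Q_def)
    then obtain v where v: "v \<in> e" "v \<in> W" using e(1) AW(2) by blast
    show ?thesis
    proof (rule contains_berge_star_sunflower[of "{f \<in> E. v \<in> f}"])
      fix f f' assume ff: "f \<in> {f \<in> E. v \<in> f}" "f' \<in> {f \<in> E. v \<in> f}" "f \<noteq> f'"
      then obtain i j where ij: "f = g i" "f' = g j" "(v, i) \<in> I" "(v, j) \<in> I"
        unfolding star_W[OF v(2)] by blast
      then have lt: "i < m" "j < m" and ne: "i \<noteq> j" using I(1) ff(3) by auto
      \<comment> \<open>At most one of the two edges is short, so one of the two fillings is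
        empty.\<close>
      have "{..<k - c i} \<inter> {..<k - c j} = {}"
        using short[OF lt(1)] short[OF lt(2)] ne by (cases "c i < k"; cases "c j < k") auto
      then have "f \<inter> f' \<inter> A = {}" using g_A[OF lt(1)] g_A[OF lt(2)] ij by blast
      moreover have "f \<inter> f' \<inter> W \<subseteq> {v}"
        using g_W[OF lt(1)] g_W[OF lt(2)] core_inter[OF ne, of v] ij by (auto simp: core_def)
      ultimately show "f \<inter> f' \<subseteq> {v}" using Ek[of f] ff(1) AW(2) by blast
    qed (use e v k l finE Ek deg_W[OF v(2)] in auto)
  qed
  ultimately have "berge_saturated (star_vertices l) (star_edges l) k {..<n} E"
    unfolding berge_saturated_def uniform_hypergraph_def using Ek by blast
  then show ?thesis using that card_E by (simp add: m_def t_def)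
qed

text \<open>The case \<open>l = 1\<close>, outside the range of the general construction: any single
  edge is already a Berge star, the sunflower having no petals.\<close>

lemma berge_saturated_star_1:
  assumes "k \<ge> 3" "finite V"
  shows "berge_saturated (star_vertices 1) (star_edges 1) k V {}"
proof -
  have "contains_berge (star_vertices 1) (star_edges 1) V {e}" if "e \<subseteq> V" "card e = k" for e
  proof -
    have "e \<noteq> {}" using that(2) assms(1) by auto
    then obtain v where "v \<in> e" by blast
    then show ?thesis
      using contains_berge_star_sunflower[of "{}" "{}" 1 v V e] that assms(1) by auto
  qed
  moreover have "\<not> contains_berge (star_vertices 1) (star_edges 1) V {}"
    by (simp add: contains_berge_def star_edges_def)
  ultimately show ?thesis
    using assms(2) by (simp add: berge_saturated_def uniform_hypergraph_def)
qed

section \<open>Arithmetic of the formula and the theorem itself\<close>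

text \<open>Each step of Pascal's rule adds at least 1 once \<open>m\<close> reaches
  \<open>j\<close>. This turns the constraint on the clique size into a bound independent of
  \<open>n\<close>.\<close>

lemma choose_ge_diff:
  assumes "1 \<le> j"
  shows "Suc m \<le> j + (m choose j)"
proof (induction m)
  case (Suc m)
  show ?case
  proof (cases "Suc m < j")
    case False
    obtain i where i: "j = Suc i" using assms by (cases j) auto
    have "1 \<le> m choose i" using False i by (simp add: Suc_le_eq)
    then show ?thesis using Suc i by simp
  qed simp
qed (use assms in simp)

lemma ceiling_divide_nat:
  assumes "k > 0"
  shows "\<lceil>real t / real k\<rceil> = int ((t + (k - 1)) div k)"
proof (rule ceiling_unique)
  let ?q = "(t + (k - 1)) div k"
  have eq: "k * ?q + (t + (k - 1)) mod k = t + (k - 1)" by simp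
  have lt: "(t + (k - 1)) mod k < k" using assms by simp
  have "t \<le> k * ?q" "k * ?q < t + k" using eq lt assms by linarith+
  then have "real t \<le> real k * real ?q" "real k * real ?q < real t + real k"
    by (metis of_nat_le_iff of_nat_mult, metis of_nat_add of_nat_less_iff of_nat_mult)
  then show "real t / real k \<le> of_int (int ?q)" "of_int (int ?q) - 1 < real t / real k"
    using assms by (simp_all add: field_simps)
qed

theorem theorem1p4:
  fixes k l :: nat
  assumes "k \<ge> 3" and "l \<ge> 1"
  shows "\<forall>\<^sub>F n in sequentially.
    int (berge_sat k n (star_vertices l) (star_edges l)) =
      Min ((\<lambda>a. \<lceil>(real l - 1) * (real n - real a) / real k\<rceil> + int (a choose k)) `
        {a \<in> {1..n}. (a - 1) choose (k - 1) \<le> l - 2})"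
proof (rule eventually_sequentiallyI)
  \<comment> \<open>The summand \<open>l + k\<close> exceeds every admissible clique size; the rest
    is the threshold of the construction.\<close>
  fix n assume n: "l + k + 2 * k ^ 3 * (l - 1) ^ 2 \<le> n"
  define val where "val a = \<lceil>(real l - 1) * (real n - real a) / real k\<rceil> + int (a choose k)" for a
  define S where "S = {a \<in> {1..n}. (a - 1) choose (k - 1) \<le> l - 2}"
  let ?sat = "berge_saturated (star_vertices l) (star_edges l) k"
  have val_nat: "val a = int (((l - 1) * (n - a) + (k - 1)) div k + (a choose k))" if "a \<le> n" for a
  proof -
    have eq: "(real l - 1) * (real n - real a) = real ((l - 1) * (n - a))"
      using assms that by (simp add: of_nat_diff)
    have "k > 0" using assms by simp
    then show ?thesis unfolding val_def eq ceiling_divide_nat[OF \<open>k > 0\<close>] by simp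
  qed
  have "finite S" by (simp add: S_def)
  have "1 \<in> S" using assms n by (simp add: S_def binomial_eq_0)
  have Min_in: "Min (val ` S) \<in> val ` S" using \<open>finite S\<close> \<open>1 \<in> S\<close> by (intro Min_in) auto
  have lower: "Min (val ` S) \<le> int (card E)" if V: "card V = n" and sat: "?sat V E" for V :: "nat set" and E
  proof -
    obtain a where a: "a \<le> n" "a = 0 \<or> (a - 1) choose (k - 1) \<le> l - 2"
      "(l - 1) * (n - a) + k * (a choose k) \<le> k * card E"
      using berge_star_saturated_card_ge[OF sat] assms V by auto
    \<comment> \<open>The integer \<open>a choose k\<close> can be moved under the rounded-up
      division, where the lower bound applies.\<close>
    have "((l - 1) * (n - a) + (k - 1)) div k + (a choose k)
        = ((l - 1) * (n - a) + (k - 1) + k * (a choose k)) div k"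
      using assms div_mult_self2[of k "(l - 1) * (n - a) + (k - 1)" "a choose k"] by linarith
    also have "\<dots> \<le> (k * card E + (k - 1)) div k" using a(3) by (intro div_le_mono) simp
    also have "\<dots> = card E" using assms by (intro div_nat_eqI) simp_all
    finally have le: "val a \<le> int (card E)" using val_nat[OF a(1)] by simp
    show ?thesis
    proof (cases "a = 0")
      \<comment> \<open>The value 0 lies outside the range of the minimum, but 1 does at least as
        well: both binomials vanish.\<close>
      case True
      have "val 1 \<le> val 0"
        unfolding val_def using assms
        by (intro add_mono ceiling_mono divide_right_mono mult_left_mono) (auto simp: binomial_eq_0)
      moreover have "Min (val ` S) \<le> val 1" using \<open>finite S\<close> \<open>1 \<in> S\<close> by simp
      ultimately show ?thesis using le True by simp
    next
      case False
      then have "a \<in> S" using a by (simp add: S_def)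
      then have "Min (val ` S) \<le> val a" using \<open>finite S\<close> by simp
      then show ?thesis using le by simp
    qed
  qed
  have upper: "\<exists>E. ?sat {..<n} E \<and> int (card E) = Min (val ` S)"
  proof (cases "l = 1")
    case True
    \<comment> \<open>At \<open>l = 1\<close> the truncated \<open>l - 2\<close> is 0, so membership
      in \<open>S\<close> forces \<open>a < k\<close>, and both terms of \<open>val a\<close>
      vanish.\<close>
    have "val a = 0" if "a \<in> S" for a
      using that True assms by (auto simp: val_def S_def binomial_eq_0_iff)
    then have "Min (val ` S) = 0" using Min_in by auto
    then show ?thesis using True berge_saturated_star_1[OF assms(1), of "{..<n}"] by auto
  next
    case False
    then have l: "l \<ge> 2" using assms by simp
    obtain b where b: "b \<in> S" "val b = Min (val ` S)" using Min_in by force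
    \<comment> \<open>With \<open>a \<ge> k - 1\<close> the clique has enough vertices to fill up the short edge.\<close>
    define a where "a = max b (k - 1)"
    have "1 \<le> k - 1" "k - 1 \<le> n" using n assms by linarith+
    then have k1: "k - 1 \<in> S" using assms by (simp add: S_def binomial_eq_0)
    then have aS: "a \<in> S" using b(1) by (simp add: a_def max_def)
    \<comment> \<open>Enlarging a clique to \<open>k - 1\<close> vertices keeps its binomial at 0
      and does not increase the other term.\<close>
    have "val a \<le> val b"
    proof (cases "b < k - 1")
      case True
      then show ?thesis
        unfolding val_def using assms
        by (intro add_mono ceiling_mono divide_right_mono mult_left_mono)
          (auto simp: binomial_eq_0 a_def)
    qed (simp add: a_def max_def)
    then have val_a: "val a = Min (val ` S)"
      using b(2) aS \<open>finite S\<close> by (metis Min_le antisym finite_imageI imageI)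
    have "Suc (a - 1) \<le> (k - 1) + ((a - 1) choose (k - 1))"
      using assms by (intro choose_ge_diff) simp
    then have "a \<le> (k - 1) + (l - 2)" using aS by (auto simp: S_def)
    then have "n > a + 2 * k ^ 3 * (l - 1) ^ 2" using n assms l by linarith
    then obtain E where "?sat {..<n} E" "card E = ((l - 1) * (n - a) + (k - 1)) div k + (a choose k)"
      using exists_berge_star_saturated[OF assms(1) l, of a n] aS by (auto simp: a_def S_def)
    then show ?thesis using val_nat[of a] val_a aS by (auto simp: S_def)
  qed
  then obtain E where E: "?sat {..<n} E" "int (card E) = Min (val ` S)" by blast
  have "berge_sat k n (star_vertices l) (star_edges l) = card E"
    unfolding berge_sat_def
  proof (rule Least_equality)
    show "\<exists>V E'. card V = n \<and> ?sat (V :: nat set) E' \<and> card E' = card E"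
      using E(1) by (intro exI[of _ "{..<n}"] exI[of _ E]) simp
  next
    fix m assume "\<exists>V E'. card V = n \<and> ?sat (V :: nat set) E' \<and> card E' = m"
    then show "card E \<le> m" using lower E(2) by fastforce
  qed
  then show "int (berge_sat k n (star_vertices l) (star_edges l)) =
      Min ((\<lambda>a. \<lceil>(real l - 1) * (real n - real a) / real k\<rceil> + int (a choose k)) `
        {a \<in> {1..n}. (a - 1) choose (k - 1) \<le> l - 2})"
    using E(2) unfolding val_def S_def by simp
qed

end
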